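(* Let $G$ be a triangle-free finite graph (multiple edges allowed, no loops) with $\delta(G)\geq 1$, and let $a,b:V(G)\to\mathbb{Z}_{\geq 1}$ be two functions such that $d_G(v)\geq a(v)+b(v)+2w_G(v)-2$ for every $v\in V(G)$. Then there is a partition $(A,B)$ of $V(G)$ into two non-empty sets such that $d_{G[A]}(v)\geq a(v)$ for all $v\in A$ and $d_{G[B]}(v)\geq b(v)$ for all $v\in B$.
   Context: Graphs are finite and undirected, may have multiple edges but no loops. Triangle-free means the underlying simple graph contains no cycle of length 3. $d_G(v)$ is the number of edges incident with $v$ (counting multiplicities), $\delta(G)$ the minimum degree. For distinct vertices $u,v$, $\mu_G(u,v)$ is the number of edges joining $u$ and $v$, and $w_G(u)=\max_{v\in V(G)\setminus\{u\}}\mu_G(u,v)$. For $X\subseteq V(G)$, $G[X]$ is the induced subgraph. A partition $(A,B)$ of $V(G)$ requires $A,B$ to be disjoint, non-empty, with union $V(G)$. *)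

theory Defs
  imports Main
begin

record ('v, 'e) multigraph =
  verts :: "'v set"
  edges :: "'e set"
  ends :: "'e \<Rightarrow> 'v set"

text \<open>Parallel edges are distinct elements of \<open>edges G\<close> with the same pair of ends; an edge has
  exactly two ends, so there are no loops. The vertex set is non-empty, so that the minimum
  degree is meaningful.\<close>

definition finite_multigraph :: "('v, 'e) multigraph \<Rightarrow> bool" where
  "finite_multigraph G \<longleftrightarrow>
     finite (verts G) \<and> verts G \<noteq> {} \<and> finite (edges G) \<and>
     (\<forall>e\<in>edges G. ends G e \<subseteq> verts G \<and> card (ends G e) = 2)"

definition degree :: "('v, 'e) multigraph \<Rightarrow> 'v \<Rightarrow> nat" where
  "degree G v = card {e \<in> edges G. v \<in> ends G e}"

definition min_degree :: "('v, 'e) multigraph \<Rightarrow> nat" where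
  "min_degree G = Min (degree G ` verts G)"

definition mult :: "('v, 'e) multigraph \<Rightarrow> 'v \<Rightarrow> 'v \<Rightarrow> nat" where
  "mult G u v = card {e \<in> edges G. ends G e = {u, v}}"

text \<open>The set under \<open>Max\<close> is empty only if \<open>u\<close> is the sole vertex, which cannot happen in a
  loopless graph of minimum degree at least 1.\<close>

definition max_mult :: "('v, 'e) multigraph \<Rightarrow> 'v \<Rightarrow> nat" where
  "max_mult G u = Max (mult G u ` (verts G - {u}))"

definition simple_edges :: "('v, 'e) multigraph \<Rightarrow> 'v set set" where
  "simple_edges G = ends G ` edges G"

text \<open>Distinctness of \<open>x\<close>, \<open>y\<close>, \<open>z\<close> is automatic in a loopless graph.\<close>

definition triangle_free :: "('v, 'e) multigraph \<Rightarrow> bool" where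
  "triangle_free G \<longleftrightarrow>
     \<not> (\<exists>x y z. distinct [x, y, z] \<and>
          {x, y} \<in> simple_edges G \<and> {y, z} \<in> simple_edges G \<and> {z, x} \<in> simple_edges G)"

definition induced :: "('v, 'e) multigraph \<Rightarrow> 'v set \<Rightarrow> ('v, 'e) multigraph" where
  "induced G X = \<lparr>verts = X, edges = {e \<in> edges G. ends G e \<subseteq> X}, ends = ends G\<rparr>"

definition vertex_partition :: "('v, 'e) multigraph \<Rightarrow> 'v set \<Rightarrow> 'v set \<Rightarrow> bool" where
  "vertex_partition G A B \<longleftrightarrow>
     A \<noteq> {} \<and> B \<noteq> {} \<and> A \<inter> B = {} \<and> A \<union> B = verts G"

end

theory Submission imports Defs begin

text \<open>
  Call a set \<open>X\<close> good for a demand \<open>f\<close> if every vertex of \<open>X\<close> has degree at least \<open>f\<close> inside \<open>X\<close>, and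
  sparse for \<open>f\<close> if it has no non-empty good subset. A pair of disjoint non-empty sets, good for \<open>a\<close>
  and \<open>b\<close> respectively, can be enlarged to a partition, so suppose that there is no such pair.
  Among all partitions \<open>(A, B)\<close> with \<open>A\<close> sparse for \<open>a + w\<close> and \<open>B\<close> sparse for \<open>b + w\<close> (one arises
  from a minimal set that is good for \<open>a\<close>), take one that maximises \<open>b(A) + a(B) - e(A, B)\<close>; one of
  the parts, say \<open>A\<close>, is even sparse for \<open>a\<close>, and among these take \<open>A\<close> of maximal size. Moving a
  vertex \<open>y \<in> B\<close> of degree less than \<open>b + w\<close> in \<open>B\<close> to \<open>A\<close> gives again an optimal partition, and now
  the other part is sparse for \<open>b\<close>. This yields a second such vertex \<open>z\<close> adjacent to \<open>y\<close>. Finally, a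
  vertex \<open>x \<in> A\<close> of degree less than \<open>a\<close> in \<open>A\<close> must be adjacent to both \<open>y\<close> and \<open>z\<close>, a triangle.
\<close>

text \<open>Integer edge weights allow degrees and demands to be subtracted freely. Of the maximal
  multiplicity only this is kept: \<open>w\<close> is positive and bounds the weights at each
  vertex.\<close>

locale weighted_graph =
  fixes V :: "'v set" and m :: "'v \<Rightarrow> 'v \<Rightarrow> int" and w :: "'v \<Rightarrow> int"
  assumes finite_V: "finite V" and V_nonempty: "V \<noteq> {}"
    and m_sym: "m u v = m v u" and m_irrefl: "m v v = 0" and m_nonneg: "0 \<le> m u v"
    and m_le_w: "u \<in> V \<Longrightarrow> v \<in> V \<Longrightarrow> m u v \<le> w u"
    and w_pos: "v \<in> V \<Longrightarrow> 1 \<le> w v"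
begin

definition deg :: "'v set \<Rightarrow> 'v \<Rightarrow> int" where
  "deg X v = (\<Sum>u\<in>X. m v u)"

definition good :: "('v \<Rightarrow> int) \<Rightarrow> 'v set \<Rightarrow> bool" where
  "good f X \<longleftrightarrow> (\<forall>v\<in>X. f v \<le> deg X v)"

definition sparse :: "('v \<Rightarrow> int) \<Rightarrow> 'v set \<Rightarrow> bool" where
  "sparse f X \<longleftrightarrow> (\<forall>Y\<subseteq>X. Y \<noteq> {} \<longrightarrow> \<not> good f Y)"

definition good_pair :: "('v \<Rightarrow> int) \<Rightarrow> ('v \<Rightarrow> int) \<Rightarrow> 'v set \<Rightarrow> 'v set \<Rightarrow> bool" where
  "good_pair a b A B \<longleftrightarrow>
     A \<subseteq> V \<and> B \<subseteq> V \<and> A \<inter> B = {} \<and> A \<noteq> {} \<and> B \<noteq> {} \<and> good a A \<and> good b B"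

definition demands :: "('v \<Rightarrow> int) \<Rightarrow> ('v \<Rightarrow> int) \<Rightarrow> bool" where
  "demands a b \<longleftrightarrow>
     (\<forall>v\<in>V. 1 \<le> a v \<and> 1 \<le> b v \<and> a v + b v + 2 * w v - 2 \<le> deg V v)"

text \<open>Up to a constant, the last term counts the edges inside the two parts. The demands enter
  crosswise, so that moving \<open>y\<close> from \<open>B\<close> to \<open>A\<close> changes the
  weight by \<open>(deg A y - a y) - (deg B y - b y)\<close>.\<close>

definition weight :: "('v \<Rightarrow> int) \<Rightarrow> ('v \<Rightarrow> int) \<Rightarrow> 'v set \<Rightarrow> 'v set \<Rightarrow> int" where
  "weight a b A B = sum b A + sum a B - (\<Sum>u\<in>A. deg B u)"

definition sparse_partition :: "('v \<Rightarrow> int) \<Rightarrow> ('v \<Rightarrow> int) \<Rightarrow> 'v set \<Rightarrow> 'v set \<Rightarrow> bool" where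
  "sparse_partition a b A B \<longleftrightarrow>
     A \<inter> B = {} \<and> A \<union> B = V \<and> sparse (\<lambda>v. a v + w v) A \<and> sparse (\<lambda>v. b v + w v) B"

definition optimal :: "('v \<Rightarrow> int) \<Rightarrow> ('v \<Rightarrow> int) \<Rightarrow> 'v set \<Rightarrow> 'v set \<Rightarrow> bool" where
  "optimal a b A B \<longleftrightarrow> sparse_partition a b A B \<and>
     (\<forall>A' B'. sparse_partition a b A' B' \<longrightarrow> weight a b A' B' \<le> weight a b A B)"

section \<open>Degrees, good sets and sparse sets\<close>

lemma finite_subset_V: "X \<subseteq> V \<Longrightarrow> finite X"
  using finite_V finite_subset by blast

lemma ex_max_card:
  assumes "P X" "\<And>X. P X \<Longrightarrow> X \<subseteq> V"
  shows "\<exists>X. P X \<and> (\<forall>Y. P Y \<longrightarrow> card Y \<le> card X)"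
  by (rule ex_has_greatest_nat[of P X card "Suc (card V)"])
    (use assms card_mono[OF finite_V] in \<open>auto simp: less_Suc_eq_le\<close>)

lemma deg_insert: "finite X \<Longrightarrow> x \<notin> X \<Longrightarrow> deg (insert x X) v = deg X v + m v x"
  by (simp add: deg_def)

lemma deg_remove: "finite X \<Longrightarrow> x \<in> X \<Longrightarrow> deg (X - {x}) v = deg X v - m v x"
  by (simp add: deg_def sum_diff1)

lemma deg_mono: "finite Y \<Longrightarrow> X \<subseteq> Y \<Longrightarrow> deg X v \<le> deg Y v"
  unfolding deg_def by (rule sum_mono2) (auto simp: m_nonneg)

lemma deg_union: "finite X \<Longrightarrow> finite Y \<Longrightarrow> X \<inter> Y = {} \<Longrightarrow> deg (X \<union> Y) v = deg X v + deg Y v"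
  unfolding deg_def by (rule sum.union_disjoint)

lemma sparse_subset: "sparse f X \<Longrightarrow> Y \<subseteq> X \<Longrightarrow> sparse f Y"
  unfolding sparse_def by blast

lemma sparse_mono:
  assumes "sparse f X" and "\<And>v. v \<in> X \<Longrightarrow> f v \<le> g v"
  shows "sparse g X"
  unfolding sparse_def
proof (intro allI impI notI)
  fix Y assume Y: "Y \<subseteq> X" "Y \<noteq> {}" and "good g Y"
  then have "good f Y" using assms(2) unfolding good_def by (meson order_trans subsetD)
  then show False using assms(1) Y unfolding sparse_def by blast
qed

lemma sparse_low_vertex:
  assumes "sparse f X" "X \<noteq> {}" obtains v where "v \<in> X" "deg X v < f v"
  using assms unfolding sparse_def good_def by (metis not_le order_refl)

text \<open>This is the purpose of the slack \<open>w\<close>: losing \<open>x\<close> costs a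
  vertex \<open>v\<close> only \<open>m v x\<close>, which is at most \<open>w v\<close>.\<close>

lemma good_remove:
  assumes "good (\<lambda>v. f v + w v) X" "X \<subseteq> V" "x \<in> X"
  shows "good f (X - {x})"
  unfolding good_def
proof
  fix v assume v: "v \<in> X - {x}"
  have "f v + w v \<le> deg X v" "m v x \<le> w v"
    using assms v m_le_w[of v x] by (auto simp: good_def)
  then show "f v \<le> deg (X - {x}) v"
    using deg_remove[OF finite_subset_V[OF assms(2)] assms(3), of v] by linarith
qed

lemma good_not_singleton:
  assumes "good (\<lambda>v. f v + w v) X" "X \<subseteq> V" "\<And>v. v \<in> V \<Longrightarrow> 1 \<le> f v" "X \<noteq> {}"
  shows "X - {x} \<noteq> {}"
proof
  assume "X - {x} = {}"
  then have X: "X = {x}" using assms(4) by blast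
  then have "f x + w x \<le> 0" using assms(1) by (simp add: good_def deg_def m_irrefl)
  moreover have "x \<in> V" using X assms(2) by blast
  ultimately show False using assms(3)[of x] w_pos[of x] by linarith
qed

text \<open>A set good for \<open>f + w\<close> can give up \<open>x\<close> and remain good for
  \<open>f\<close>; it does not become empty, since a single vertex has degree 0.\<close>

lemma sparse_insert:
  assumes "sparse f X" "insert x X \<subseteq> V" "\<And>v. v \<in> V \<Longrightarrow> 1 \<le> f v"
  shows "sparse (\<lambda>v. f v + w v) (insert x X)"
  unfolding sparse_def
proof (intro allI impI notI)
  fix Y assume Y: "Y \<subseteq> insert x X" "Y \<noteq> {}" and g: "good (\<lambda>v. f v + w v) Y"
  have YV: "Y \<subseteq> V" using Y assms(2) by blast
  obtain Z where "Z \<subseteq> X" "Z \<noteq> {}" "good f Z"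
  proof (cases "x \<in> Y")
    case True
    show ?thesis
      using that[of "Y - {x}"] good_remove[OF g YV True] good_not_singleton[OF g YV assms(3) Y(2)] Y
      by blast
  next
    case False
    have "good f Y" unfolding good_def
    proof
      fix v assume "v \<in> Y"
      then show "f v \<le> deg Y v" using g YV w_pos[of v] unfolding good_def by fastforce
    qed
    then show ?thesis using that[of Y] Y False by blast
  qed
  then show False using assms(1) unfolding sparse_def by blast
qed

section \<open>Exchanging the two parts, and moving a vertex between them\<close>

lemma demands_swap: "demands a b \<Longrightarrow> demands b a"
  unfolding demands_def by (simp add: add.commute)

lemma sparse_partition_swap: "sparse_partition a b A B \<longleftrightarrow> sparse_partition b a B A"
  unfolding sparse_partition_def by (auto simp: Un_commute Int_commute)

lemma weight_swap: "weight a b A B = weight b a B A"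
proof -
  have "(\<Sum>u\<in>A. deg B u) = (\<Sum>u\<in>B. deg A u)"
    unfolding deg_def by (subst sum.swap) (simp add: m_sym)
  then show ?thesis unfolding weight_def by simp
qed

lemma optimal_swap: "optimal a b A B \<Longrightarrow> optimal b a B A"
  unfolding optimal_def by (metis sparse_partition_swap weight_swap)

lemma good_pair_swap: "good_pair a b A B \<Longrightarrow> good_pair b a B A"
  unfolding good_pair_def by blast

lemma weight_move:
  assumes "finite A" "finite B" "A \<inter> B = {}" "y \<in> B"
  shows "weight a b (insert y A) (B - {y}) =
    weight a b A B + deg A y - deg B y + b y - a y"
proof -
  have yA: "y \<notin> A" using assms by blast
  have "(\<Sum>u\<in>A. deg (B - {y}) u) = (\<Sum>u\<in>A. deg B u) - (\<Sum>u\<in>A. m u y)"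
    by (simp add: deg_remove assms sum_subtractf)
  also have "(\<Sum>u\<in>A. m u y) = deg A y" unfolding deg_def by (simp add: m_sym)
  finally have "(\<Sum>u\<in>insert y A. deg (B - {y}) u) = (\<Sum>u\<in>A. deg B u) - deg A y + deg B y"
    using assms yA by (simp add: deg_remove m_irrefl)
  moreover have "sum a (B - {y}) = sum a B - a y" using assms by (simp add: sum_diff1)
  ultimately show ?thesis unfolding weight_def using assms yA by simp
qed

text \<open>The whole of \<open>V\<close> is good for \<open>b + w\<close>, because
  \<open>a + w \<ge> 2\<close>, so it cannot be the second part.\<close>

lemma sparse_partition_nonempty:
  assumes "demands a b" "sparse_partition a b A B"
  shows "A \<noteq> {}"
proof
  assume "A = {}"
  then have "B = V" using assms(2) unfolding sparse_partition_def by blast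
  then have "sparse (\<lambda>v. b v + w v) V" using assms(2) unfolding sparse_partition_def by blast
  then obtain v where v: "v \<in> V" "deg V v < b v + w v"
    by (rule sparse_low_vertex[OF _ V_nonempty])
  have "1 \<le> a v" "a v + b v + 2 * w v - 2 \<le> deg V v"
    using assms(1) v unfolding demands_def by auto
  then show False using v w_pos[of v] by linarith
qed

lemma optimal_move:
  assumes dem: "demands a b" and opt: "optimal a b A B" and sp: "sparse a A"
    and y: "y \<in> B" "deg B y < b y + w y"
  shows "optimal a b (insert y A) (B - {y})" and "deg B y = b y + w y - 1"
proof -
  have part: "A \<inter> B = {}" "A \<union> B = V" "sparse (\<lambda>v. b v + w v) B"
    using opt unfolding optimal_def sparse_partition_def by blast+
  have fin: "finite A" "finite B" and yV: "y \<in> V" using part y finite_subset_V by blast+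
  have "sparse (\<lambda>v. a v + w v) (insert y A)"
    using sparse_insert[OF sp, of y] part y dem unfolding demands_def by blast
  moreover have "sparse (\<lambda>v. b v + w v) (B - {y})" using part(3) sparse_subset by blast
  ultimately have sp': "sparse_partition a b (insert y A) (B - {y})"
    unfolding sparse_partition_def using part y by blast
  have "weight a b (insert y A) (B - {y}) \<le> weight a b A B"
    using opt sp' unfolding optimal_def by blast
  moreover have "a y + b y + 2 * w y - 2 \<le> deg V y" using dem yV unfolding demands_def by blast
  moreover have "deg V y = deg A y + deg B y"
    using deg_union[OF fin part(1), of y] part(2) by simp
  moreover note weight_move[OF fin part(1) y(1), of a b] y(2)
  \<comment> \<open>The gain in weight is at least \<open>2 * (b y + w y - 1 - deg B y)\<close>,
    which is non-negative by the choice of \<open>y\<close>; optimality forces it to be 0.\<close>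
  ultimately have "deg B y = b y + w y - 1 \<and>
      weight a b (insert y A) (B - {y}) = weight a b A B"
    by linarith
  then show "deg B y = b y + w y - 1" and "optimal a b (insert y A) (B - {y})"
    using sp' opt unfolding optimal_def by auto
qed

text \<open>A vertex of \<open>B\<close> with degree below \<open>b + w\<close> could be moved, and
  \<open>optimal_move\<close> shows that it misses that bound by exactly one.\<close>

lemma optimal_good:
  assumes "demands a b" "optimal a b A B" "sparse a A"
  shows "good (\<lambda>v. b v + w v - 1) B"
  unfolding good_def using optimal_move(2)[OF assms] by fastforce

section \<open>The triangle\<close>

lemma triangle_if_optimal_sparse:
  assumes dem: "demands a b" and nopair: "\<nexists>A B. good_pair a b A B"
    and ex: "optimal a b A\<^sub>0 B\<^sub>0" "sparse a A\<^sub>0"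
  shows "\<exists>x\<in>V. \<exists>y\<in>V. \<exists>z\<in>V. 0 < m x y \<and> 0 < m y z \<and> 0 < m z x"
proof -
  let ?P = "\<lambda>A. \<exists>B. optimal a b A B \<and> sparse a A"
  have "\<exists>A. ?P A \<and> (\<forall>A'. ?P A' \<longrightarrow> card A' \<le> card A)"
  proof (rule ex_max_card)
    show "?P A\<^sub>0" using ex by blast
    show "A \<subseteq> V" if "?P A" for A
      using that unfolding optimal_def sparse_partition_def by blast
  qed
  then obtain A B where opt: "optimal a b A B" and sp: "sparse a A"
    and maxA: "\<And>A' B'. optimal a b A' B' \<Longrightarrow> sparse a A' \<Longrightarrow> card A' \<le> card A"
    by blast
  have part: "sparse_partition a b A B" using opt unfolding optimal_def by blast
  then have AB: "A \<inter> B = {}" "A \<union> B = V" "sparse (\<lambda>v. b v + w v) B"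
    unfolding sparse_partition_def by auto
  then have fin: "finite A" "finite B" using finite_subset_V by blast+
  \<comment> \<open>This vertex is fixed before any move, so that it serves for both
    \<open>y\<close> and \<open>z\<close>.\<close>
  obtain x where x: "x \<in> A" "deg A x < a x"
    by (rule sparse_low_vertex[OF sp sparse_partition_nonempty[OF dem part]])
  have xV: "x \<in> V" using x AB by blast
  have low: "sparse b (B - {y}) \<and> 0 < m x y" if y: "y \<in> B" "deg B y < b y + w y" for y
  proof -
    have opt': "optimal a b (insert y A) (B - {y})" using optimal_move(1)[OF dem opt sp y] .
    have yA: "y \<notin> A" using y AB by blast
    \<comment> \<open>Otherwise the enlarged part would contradict the maximal size of
      \<open>A\<close>. The good set found in it rules out sets good for \<open>b\<close> in
      \<open>B - {y}\<close>.\<close>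
    have "\<not> sparse a (insert y A)" using maxA[OF opt'] fin yA by auto
    then obtain X where X: "X \<subseteq> insert y A" "X \<noteq> {}" "good a X" unfolding sparse_def by blast
    have spB: "sparse b (B - {y})" unfolding sparse_def
    proof (intro allI impI notI)
      fix Y assume "Y \<subseteq> B - {y}" "Y \<noteq> {}" "good b Y"
      then have "good_pair a b X Y" using X AB y unfolding good_pair_def by blast
      then show False using nopair by blast
    qed
    \<comment> \<open>After the move it is the second part that is sparse for its own demand, so the
      roles of \<open>a\<close> and \<open>b\<close> are exchanged.\<close>
    have "good (\<lambda>v. a v + w v - 1) (insert y A)"
      using optimal_good[OF demands_swap[OF dem] optimal_swap[OF opt'] spB] .
    then have "a x + w x - 1 \<le> deg (insert y A) x" using x unfolding good_def by blast
    \<comment> \<open>The move lifts the degree of \<open>x\<close> from below \<open>a x\<close> to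
      at least \<open>a x\<close>, so \<open>y\<close> must be a neighbour.\<close>
    then have "0 < m x y" using x(2) w_pos[OF xV] deg_insert[OF fin(1) yA, of x] by linarith
    then show ?thesis using spB by blast
  qed
  have "B \<noteq> {}"
    using sparse_partition_nonempty[OF demands_swap[OF dem]] part sparse_partition_swap by blast
  then obtain y where y: "y \<in> B" "deg B y < b y + w y" by (rule sparse_low_vertex[OF AB(3)])
  have "sparse_partition a b (insert y A) (B - {y})"
    using optimal_move(1)[OF dem opt sp y] unfolding optimal_def by blast
  then have "B - {y} \<noteq> {}"
    using sparse_partition_nonempty[OF demands_swap[OF dem]] sparse_partition_swap by blast
  then obtain z where z: "z \<in> B - {y}" "deg (B - {y}) z < b z"
    by (rule sparse_low_vertex[OF conjunct1[OF low[OF y]]])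
  have yV: "y \<in> V" and zV: "z \<in> V" using y z AB by blast+
  have degz: "deg (B - {y}) z = deg B z - m z y" using deg_remove[OF fin(2) y(1)] .
  \<comment> \<open>Putting \<open>y\<close> back adds at most \<open>w z\<close>, so
    \<open>z\<close> is low in \<open>B\<close> as well and \<open>low\<close> applies to
    it.\<close>
  then have zlow: "deg B z < b z + w z" using z(2) m_le_w[OF zV yV] by linarith
  have "b z + w z - 1 \<le> deg B z" using optimal_good[OF dem opt sp] z(1) unfolding good_def by blast
  \<comment> \<open>The degree of \<open>z\<close> is at least \<open>b z\<close> in
    \<open>B\<close> but smaller without \<open>y\<close>.\<close>
  then have "0 < m z y" using degz z(2) w_pos[OF zV] by linarith
  moreover have "0 < m x y" "0 < m x z" using low y z zlow by blast+
  ultimately show ?thesis using xV yV zV m_sym by metis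
qed

section \<open>Existence of an optimal partition and of a good pair\<close>

lemma optimal_exists:
  assumes dem: "demands a b" and nopair: "\<nexists>A B. good_pair a b A B"
  shows "\<exists>A B. optimal a b A B"
proof -
  have pos: "1 \<le> a v" "1 \<le> b v" if "v \<in> V" for v using dem that unfolding demands_def by auto
  have goodV: "good a V" unfolding good_def
  proof
    fix v assume v: "v \<in> V"
    then have "a v + b v + 2 * w v - 2 \<le> deg V v" using dem unfolding demands_def by blast
    then show "a v \<le> deg V v" using pos[OF v] w_pos[OF v] by linarith
  qed
  let ?P = "\<lambda>X. X \<subseteq> V \<and> X \<noteq> {} \<and> good a X"
  have "?P V" using goodV V_nonempty by simp
  then have "\<exists>A. ?P A \<and> (\<forall>X. ?P X \<longrightarrow> card A \<le> card X)" by (rule ex_has_least_nat)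
  then obtain A where A: "?P A" and least: "\<And>X. ?P X \<Longrightarrow> card A \<le> card X" by blast
  have min: "X = A" if "?P X" "X \<subseteq> A" for X
    using card_seteq[OF _ that(2) least[OF that(1)]] finite_subset_V A by blast
  have spA: "sparse (\<lambda>v. a v + w v) A" unfolding sparse_def
  proof (intro allI impI notI)
    fix Y assume Y: "Y \<subseteq> A" "Y \<noteq> {}" "good (\<lambda>v. a v + w v) Y"
    then obtain y where y: "y \<in> Y" by blast
    have "Y \<subseteq> V" using Y A by blast
    \<comment> \<open>Dropping one vertex leaves a set still good for \<open>a\<close>, against the
      minimality of \<open>A\<close>.\<close>
    then have "?P (Y - {y})"
      using good_remove[OF Y(3) _ y] good_not_singleton[OF Y(3) _ pos(1) Y(2)] by blast
    then show False using min[of "Y - {y}"] y Y by blast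
  qed
  \<comment> \<open>As \<open>A\<close> is good for \<open>a\<close>, a set good for
    \<open>b\<close> outside it would complete a pair.\<close>
  have "sparse b (V - A)" unfolding sparse_def
  proof (intro allI impI notI)
    fix Y assume "Y \<subseteq> V - A" "Y \<noteq> {}" "good b Y"
    then have "good_pair a b A Y" using A unfolding good_pair_def by blast
    then show False using nopair by blast
  qed
  then have "sparse (\<lambda>v. b v + w v) (V - A)"
    by (rule sparse_mono) (use w_pos in force)
  then have part: "sparse_partition a b A (V - A)"
    using spA A unfolding sparse_partition_def by blast
  let ?S = "{(A, B). sparse_partition a b A B}" and ?f = "case_prod (weight a b)"
  have "finite ?S"
    by (rule finite_subset[of _ "Pow V \<times> Pow V"])
      (use finite_V in \<open>auto simp: sparse_partition_def\<close>)
  then have fin: "finite (?f ` ?S)" by simp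
  have "?f ` ?S \<noteq> {}" using part by blast
  then obtain A' B' where "sparse_partition a b A' B'" "Max (?f ` ?S) = weight a b A' B'"
    using Max_in[OF fin] by auto
  moreover have "weight a b C D \<le> Max (?f ` ?S)" if "sparse_partition a b C D" for C D
    by (rule Max_ge[OF fin]) (use that in force)
  ultimately show ?thesis unfolding optimal_def by auto
qed

lemma good_pair_exists:
  assumes dem: "demands a b"
    and tf: "\<not> (\<exists>x\<in>V. \<exists>y\<in>V. \<exists>z\<in>V. 0 < m x y \<and> 0 < m y z \<and> 0 < m z x)"
  shows "\<exists>A B. good_pair a b A B"
proof (rule ccontr)
  assume nopair: "\<nexists>A B. good_pair a b A B"
  then obtain A B where opt: "optimal a b A B" using optimal_exists dem by blast
  then have AB: "A \<inter> B = {}" "A \<union> B = V" unfolding optimal_def sparse_partition_def by auto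
  have nopair': "\<nexists>A B. good_pair b a A B" using nopair good_pair_swap by blast
  \<comment> \<open>Good subsets of both parts would form a good pair.\<close>
  have "sparse a A \<or> sparse b B"
  proof (rule ccontr)
    assume "\<not> (sparse a A \<or> sparse b B)"
    then obtain X Y where "X \<subseteq> A" "X \<noteq> {}" "good a X" "Y \<subseteq> B" "Y \<noteq> {}" "good b Y"
      unfolding sparse_def by blast
    then have "good_pair a b X Y" using AB unfolding good_pair_def by blast
    then show False using nopair by blast
  qed
  then show False
  proof
    assume "sparse a A"
    from tf triangle_if_optimal_sparse[OF dem nopair opt this] show False by (rule notE)
  next
    assume "sparse b B"
    from tf triangle_if_optimal_sparse[OF demands_swap[OF dem] nopair' optimal_swap[OF opt] this]
    show False by (rule notE)
  qed
qed

section \<open>From a good pair to a partition\<close>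

lemma good_partition_if_pair:
  assumes dem: "demands a b" and ex: "good_pair a b A\<^sub>0 B\<^sub>0"
  shows "\<exists>A B. good_pair a b A B \<and> A \<union> B = V"
proof -
  let ?P = "\<lambda>A. \<exists>B. good_pair a b A B"
  have "\<exists>A. ?P A \<and> (\<forall>A'. ?P A' \<longrightarrow> card A' \<le> card A)"
  proof (rule ex_max_card)
    show "?P A\<^sub>0" using ex by blast
    show "A \<subseteq> V" if "?P A" for A using that unfolding good_pair_def by blast
  qed
  then obtain A B where AB: "good_pair a b A B"
    and maxA: "\<And>A' B'. good_pair a b A' B' \<Longrightarrow> card A' \<le> card A"
    by blast
  have A: "A \<subseteq> V" "B \<subseteq> V" "A \<inter> B = {}" "A \<noteq> {}" "B \<noteq> {}" "good a A" "good b B"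
    using AB unfolding good_pair_def by auto
  then have fin: "finite A" "finite B" "finite (V - A)" using finite_subset_V by auto
  have "good b (V - A)" unfolding good_def
  proof (rule ccontr, clarsimp)
    fix v assume v: "v \<in> V" "v \<notin> A" and less: "\<not> b v \<le> deg (V - A) v"
    have "v \<notin> B"
    proof
      assume "v \<in> B"
      then have "b v \<le> deg B v" using A unfolding good_def by blast
      also have "\<dots> \<le> deg (V - A) v" using deg_mono[OF fin(3)] A by blast
      finally show False using less by blast
    qed
    have "deg V v = deg A v + deg (V - A) v"
      using deg_union[OF fin(1,3), of v] A by (simp add: Un_absorb1)
    moreover have "a v + b v + 2 * w v - 2 \<le> deg V v" using dem v unfolding demands_def by blast
    \<comment> \<open>Having degree at most \<open>b v - 1\<close> outside \<open>A\<close>, the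
      vertex \<open>v\<close> has at least \<open>a v + 2 * w v - 1\<close> inside and could join
      \<open>A\<close>.\<close>
    ultimately have av: "a v \<le> deg A v" using less w_pos[OF v(1)] by linarith
    have "good a (insert v A)" unfolding good_def
    proof
      fix u assume "u \<in> insert v A"
      then have "a u \<le> deg A u" using av A unfolding good_def by blast
      also have "\<dots> \<le> deg (insert v A) u" using deg_mono[of "insert v A" A u] fin by blast
      finally show "a u \<le> deg (insert v A) u" .
    qed
    then have "good_pair a b (insert v A) B" using A v \<open>v \<notin> B\<close> unfolding good_pair_def by blast
    then show False using maxA v fin by fastforce
  qed
  then have "good_pair a b A (V - A)" using A unfolding good_pair_def by blast
  moreover have "A \<union> (V - A) = V" using A(1) by blast
  ultimately show ?thesis by (intro exI[of _ A] exI[of _ "V - A"] conjI)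
qed

end

section \<open>Multigraphs as weighted graphs\<close>

text \<open>The edges at \<open>v\<close> are sorted by their other end \<open>u\<close>; the class
  \<open>u = v\<close> is empty, as there are no loops.\<close>

lemma degree_induced_eq_sum:
  assumes fin: "finite_multigraph G" and X: "X \<subseteq> verts G" "v \<in> X"
  shows "degree (induced G X) v = (\<Sum>u\<in>X. mult G v u)"
proof -
  have finX: "finite X" and finE: "finite (edges G)"
    using fin X finite_subset unfolding finite_multigraph_def by auto
  have card2: "card (ends G e) = 2" if "e \<in> edges G" for e
    using fin that unfolding finite_multigraph_def by blast
  have "{e \<in> edges (induced G X). v \<in> ends (induced G X) e} =
      (\<Union>u\<in>X. {e \<in> edges G. ends G e = {v, u}})" (is "?L = ?R")
  proof
    show "?L \<subseteq> ?R"
    proof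
      fix e assume "e \<in> ?L"
      then have e: "e \<in> edges G" "ends G e \<subseteq> X" "v \<in> ends G e" by (auto simp: induced_def)
      obtain p q where "ends G e = {p, q}" using card2[OF e(1)] card_2_iff by metis
      then obtain u where "ends G e = {v, u}" using e(3) by (auto simp: insert_commute)
      then show "e \<in> ?R" using e by auto
    qed
  qed (use X in \<open>auto simp: induced_def\<close>)
  then have "degree (induced G X) v = card ?R" unfolding degree_def by simp
  also have "\<dots> = (\<Sum>u\<in>X. mult G v u)"
    unfolding mult_def using finX finE
    by (subst card_UN_disjoint) (auto simp: doubleton_eq_iff)
  finally show ?thesis .
qed

lemma degree_eq_sum:
  assumes fin: "finite_multigraph G" and v: "v \<in> verts G"
  shows "degree G v = (\<Sum>u\<in>verts G. mult G v u)"
proof -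
  have "degree (induced G (verts G)) v = degree G v"
    using fin unfolding degree_def induced_def finite_multigraph_def
    by (auto intro!: arg_cong[where f = card])
  then show ?thesis using degree_induced_eq_sum[OF fin subset_refl v] by simp
qed

lemma mult_self: "finite_multigraph G \<Longrightarrow> mult G v v = 0"
  unfolding mult_def finite_multigraph_def by (auto simp: card_eq_0_iff)

lemma mult_commute: "mult G u v = mult G v u"
  unfolding mult_def by (simp add: insert_commute)

lemma mult_le_max_mult:
  assumes "finite_multigraph G" "u \<in> verts G" "v \<in> verts G"
  shows "mult G u v \<le> max_mult G u"
proof (cases "u = v")
  case False
  then show ?thesis
    unfolding max_mult_def using assms by (intro Max_ge) (auto simp: finite_multigraph_def)
qed (use assms in \<open>simp add: mult_self\<close>)

lemma max_mult_pos:
  assumes "finite_multigraph G" "v \<in> verts G" "min_degree G \<ge> 1"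
  shows "1 \<le> max_mult G v"
proof -
  have "min_degree G \<le> degree G v"
    unfolding min_degree_def using assms by (intro Min_le) (auto simp: finite_multigraph_def)
  then have "(\<Sum>u\<in>verts G. mult G v u) \<noteq> 0" using assms degree_eq_sum by fastforce
  then obtain u where "u \<in> verts G" "mult G v u \<noteq> 0" by (meson sum.neutral)
  then show ?thesis using mult_le_max_mult[OF assms(1,2), of u] by linarith
qed

lemma mult_pos_simple_edge: "0 < mult G u v \<Longrightarrow> {u, v} \<in> simple_edges G"
  unfolding mult_def simple_edges_def by (auto simp: card_gt_0_iff)

theorem theorem2:
  fixes G :: "('v, 'e) multigraph" and a b :: "'v \<Rightarrow> int"
  assumes "finite_multigraph G"
    and "triangle_free G"
    and "min_degree G \<ge> 1"
    and "\<forall>v\<in>verts G. a v \<ge> 1"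
    and "\<forall>v\<in>verts G. b v \<ge> 1"
    and "\<forall>v\<in>verts G. int (degree G v) \<ge> a v + b v + 2 * int (max_mult G v) - 2"
  shows "\<exists>A B. vertex_partition G A B \<and>
           (\<forall>v\<in>A. int (degree (induced G A) v) \<ge> a v) \<and>
           (\<forall>v\<in>B. int (degree (induced G B) v) \<ge> b v)"
proof -
  note fin = assms(1)
  interpret weighted_graph "verts G" "\<lambda>u v. int (mult G u v)" "\<lambda>v. int (max_mult G v)"
  proof
    show "finite (verts G)" "verts G \<noteq> {}" using fin unfolding finite_multigraph_def by auto
    show "int (mult G u v) = int (mult G v u)" for u v by (simp add: mult_commute)
    show "int (mult G v v) = 0" for v by (simp add: mult_self[OF fin])
    show "int (mult G u v) \<le> int (max_mult G u)" if "u \<in> verts G" "v \<in> verts G" for u v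
      using mult_le_max_mult[OF fin that] by simp
    show "1 \<le> int (max_mult G v)" if "v \<in> verts G" for v
      using max_mult_pos[OF fin that assms(3)] by simp
  qed simp
  have "demands a b"
    unfolding demands_def deg_def using assms by (simp add: degree_eq_sum)
  moreover have "\<not> (\<exists>x\<in>verts G. \<exists>y\<in>verts G. \<exists>z\<in>verts G.
      0 < int (mult G x y) \<and> 0 < int (mult G y z) \<and> 0 < int (mult G z x))"
  proof (intro notI, elim bexE conjE)
    fix x y z
    assume "0 < int (mult G x y)" "0 < int (mult G y z)" "0 < int (mult G z x)"
    then have pos: "0 < mult G x y" "0 < mult G y z" "0 < mult G z x" by simp_all
    \<comment> \<open>Two equal vertices would give a loop.\<close>
    then have "distinct [x, y, z]" using mult_self[OF fin] by auto
    moreover note pos[THEN mult_pos_simple_edge]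
    ultimately show False using assms(2) unfolding triangle_free_def by blast
  qed
  ultimately have "\<exists>A B. good_pair a b A B" by (rule good_pair_exists)
  then obtain A B where AB: "good_pair a b A B" "A \<union> B = verts G"
    using good_partition_if_pair[OF \<open>demands a b\<close>] by blast
  then have "vertex_partition G A B" unfolding vertex_partition_def good_pair_def by blast
  moreover have "\<forall>v\<in>A. int (degree (induced G A) v) \<ge> a v"
      "\<forall>v\<in>B. int (degree (induced G B) v) \<ge> b v"
    using AB degree_induced_eq_sum[OF fin] unfolding good_pair_def good_def deg_def by auto
  ultimately show ?thesis by blast
qed

end
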